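(* Let $\mathcal{B}(x)=\Gamma(x)^2/\Gamma(2x)$ and $\mathcal{R}(x)=-2\psi(x)-2\gamma$ for $x>0$. The function $x\mapsto\mathcal{R}(x)/\mathcal{B}(x)$ is strictly decreasing and concave on $(0,\infty)$, with $$\lim_{x\to0^+}\frac{\mathcal{R}(x)}{\mathcal{B}(x)}=1\quad\text{and}\quad\lim_{x\to\infty}\frac{\mathcal{R}(x)}{\mathcal{B}(x)}=-\infty.$$ In particular, $x\mapsto\mathcal{R}(x)/\mathcal{B}(x)$ is strictly decreasing and concave from $(0,1)$ onto $(0,1)$.
   Context: $\Gamma$ is the gamma function, $\psi(x)=\frac{d}{dx}\ln\Gamma(x)$ is the psi (digamma) function, and $\gamma=-\psi(1)$ is the Euler constant. *)

theory Defs
  imports "HOL-Analysis.Analysis"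
begin

text \<open>
  On the positive reals, Digamma is the derivative of the logarithm of Gamma, and
  the constant \<open>euler_mascheroni\<close> equals \<open>- Digamma 1\<close>.
  Both functions below are meant for positive arguments only; their values elsewhere are irrelevant.
\<close>

definition calB :: "real \<Rightarrow> real" where
  "calB x = Gamma x ^ 2 / Gamma (2 * x)"

definition calR :: "real \<Rightarrow> real" where
  "calR x = - 2 * Digamma x - 2 * euler_mascheroni"

end

theory Submission
  imports Defs
begin

text \<open>
  Put \<open>S(x) = \<psi>(1 + x) + \<gamma>\<close> and \<open>P(x) = \<Gamma>(1 + 2x) / \<Gamma>(1 + x)^2\<close>. The functional equations
  remove the singularity at 0: the quotient is \<open>F = (1 - x S) P\<close>, which is smooth for
  \<open>x > -1/2\<close>, with \<open>F(0) = 1\<close> and \<open>F'(0) = 0\<close>. With \<open>g = P' / (2 P) = \<psi>(1 + 2x) - \<psi>(1 + x)\<close>,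
  \<open>F'' / P = - ((x S)'' - 2 g') - 2 x S g' - 4 (x S)' g + 4 (1 - x S) g^2\<close>.
  The series of the polygamma functions give \<open>(x S)'' \<ge> 2 g'\<close> and \<open>(x S)' \<ge> 2 g\<close> termwise, while
  \<open>g' \<ge> 0\<close> follows from the duplication formula \<open>4 \<psi>'(2x) = \<psi>'(x) + \<psi>'(x + 1/2)\<close>. Hence
  \<open>F'' / P \<le> - 4 g^2 < 0\<close> for \<open>x > 0\<close>, so that \<open>F' < F'(0) = 0\<close>, and everything else follows.
  Below, \<open>S\<close>, \<open>P\<close>, \<open>g\<close>, \<open>F\<close> and \<open>F' / P\<close> are \<open>psi_shift\<close>, \<open>central_binom\<close>, \<open>psi_gap\<close>, \<open>quot\<close>
  and \<open>quot_deriv_factor\<close>.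
\<close>

section \<open>Series and inequalities for the polygamma functions\<close>

lemma Digamma_sums:
  fixes z :: "'a::{real_normed_field,banach}"
  assumes "z \<noteq> 0"
  shows "(\<lambda>n. inverse (of_nat (Suc n)) - inverse (z + of_nat n)) sums (Digamma z + euler_mascheroni)"
  using summable_sums[OF summable_Digamma[OF assms]] by (simp add: Digamma_def)

lemma trigamma_sums:
  fixes z :: "'a::{real_normed_field,banach}"
  assumes "z \<noteq> 0"
  shows "(\<lambda>n. 1 / (z + of_nat n)^2) sums Polygamma 1 z"
  using Polygamma_LIMSEQ[OF assms, of 1] by (simp add: inverse_eq_divide power2_eq_square)

lemma tetragamma_sums:
  fixes z :: "'a::{real_normed_field,banach}"
  assumes "z \<noteq> 0"
  shows "(\<lambda>n. - 2 / (z + of_nat n)^3) sums Polygamma 2 z"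
  using sums_mult[OF Polygamma_LIMSEQ[OF assms, of 2], of "-2"]
  by (simp add: inverse_eq_divide eval_nat_numeral)

text \<open>The series at \<open>2 * x\<close> is split into even and odd indices; a factor 2 taken
  out of each base turns the two halves into the series at \<open>x\<close> and at
  \<open>x + 1/2\<close>.\<close>

lemma trigamma_double:
  fixes x :: real
  assumes "x > 0"
  shows "4 * Polygamma 1 (2 * x) = Polygamma 1 x + Polygamma 1 (x + 1/2)"
proof -
  have "(\<lambda>n. 4 * (1 / (2 * x + of_nat n)^2)) sums (4 * Polygamma 1 (2 * x))"
    using assms by (intro sums_mult trigamma_sums) auto
  from sums_group[OF this, of 2]
  have "(\<lambda>n. 4 / (2 * x + of_nat (2 * n))^2 + 4 / (2 * x + of_nat (2 * n + 1))^2) sums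
      (4 * Polygamma 1 (2 * x))"
    by (simp add: mult.commute eval_nat_numeral)
  moreover have "4 / (2 * x + of_nat (2 * n))^2 + 4 / (2 * x + of_nat (2 * n + 1))^2 =
      1 / (x + of_nat n)^2 + 1 / (x + 1/2 + of_nat n)^2" for n
  proof -
    have "2 * x + of_nat (2 * n) = 2 * (x + of_nat n)"
      and "2 * x + of_nat (2 * n + 1) = 2 * (x + 1/2 + of_nat n)"
      by simp_all
    then show ?thesis
      by (simp only: power_mult_distrib) simp
  qed
  ultimately have "(\<lambda>n. 1 / (x + of_nat n)^2 + 1 / (x + 1/2 + of_nat n)^2) sums
      (4 * Polygamma 1 (2 * x))"
    by simp
  moreover have "(\<lambda>n. 1 / (x + of_nat n)^2 + 1 / (x + 1/2 + of_nat n)^2) sums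
      (Polygamma 1 x + Polygamma 1 (x + 1/2))"
    using assms by (intro sums_add trigamma_sums) auto
  ultimately show ?thesis
    by (rule sums_unique2)
qed

text \<open>Shifting every argument by 1 in the duplication formula cancels the terms
  \<open>1 / x^2\<close> and leaves 4 \<psi>'(1 + 2x) = \<psi>'(1 + x) + \<psi>'(x + 1/2). The last
  summand is at least \<psi>'(1 + x), as \<psi>' decreases.\<close>

lemma trigamma_le_twice_trigamma_double:
  fixes x :: real
  assumes "x > 0"
  shows "Polygamma 1 (1 + x) \<le> 2 * Polygamma 1 (1 + 2 * x)"
proof -
  have "Polygamma 1 (x + 1) \<le> Polygamma 1 (x + 1/2)"
    using Polygamma_real_strict_antimono[of "x + 1/2" "x + 1" 1] assms by simp
  moreover have "Polygamma 1 (x + 1) = Polygamma 1 x - 1 / x^2"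
    using Polygamma_plus1[of x 1] assms by (simp add: power2_eq_square)
  moreover have "Polygamma 1 (2 * x + 1) = Polygamma 1 (2 * x) - 1 / (2 * x)^2"
    using Polygamma_plus1[of "2 * x" 1] assms by (simp add: power2_eq_square)
  ultimately show ?thesis
    using trigamma_double[OF assms] by (simp add: add.commute power_mult_distrib)
qed

lemma Digamma_double_diff_le:
  fixes x :: real
  assumes "x > 0"
  shows "2 * (Digamma (1 + 2 * x) - Digamma (1 + x)) \<le>
    Digamma (1 + x) + euler_mascheroni + x * Polygamma 1 (1 + x)"
proof -
  have 1: "(\<lambda>n. 2 * ((inverse (of_nat (Suc n)) - inverse (1 + 2 * x + of_nat n)) -
        (inverse (of_nat (Suc n)) - inverse (1 + x + of_nat n)))) sums
      (2 * ((Digamma (1 + 2 * x) + euler_mascheroni) - (Digamma (1 + x) + euler_mascheroni)))"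
    using assms by (intro sums_mult sums_diff Digamma_sums) auto
  have 2: "(\<lambda>n. (inverse (of_nat (Suc n)) - inverse (1 + x + of_nat n)) +
        x * (1 / (1 + x + of_nat n)^2)) sums
      ((Digamma (1 + x) + euler_mascheroni) + x * Polygamma 1 (1 + x))"
    using assms by (intro sums_mult sums_add Digamma_sums trigamma_sums) auto
  have "2 * ((inverse (of_nat (Suc n)) - inverse (1 + 2 * x + of_nat n)) -
        (inverse (of_nat (Suc n)) - inverse (1 + x + of_nat n))) \<le>
      (inverse (of_nat (Suc n)) - inverse (1 + x + of_nat n)) + x * (1 / (1 + x + of_nat n)^2)" for n
  proof -
    define k where "k = 1 + real n"
    have k: "k > 0"
      by (simp add: k_def)
    \<comment> \<open>One of the two copies of \<open>x / (k + x)^2\<close> is kept for the trigamma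
      series; the other is enlarged to a difference of reciprocals for the digamma series.\<close>
    have "2 * (1 / (k + x) - 1 / (k + 2 * x)) = 2 * x / ((k + x) * (k + 2 * x))"
      using k assms by (simp add: divide_simps)
    also have "\<dots> \<le> 2 * x / ((k + x) * (k + x))"
      using k assms by (intro divide_left_mono mult_left_mono mult_pos_pos) auto
    also have "\<dots> = x / (k + x)^2 + x / ((k + x) * (k + x))"
      by (simp add: power2_eq_square)
    also have "\<dots> \<le> x / (k + x)^2 + x / (k * (k + x))"
      using k assms by (intro add_left_mono divide_left_mono mult_right_mono mult_pos_pos) auto
    also have "x / (k * (k + x)) = 1 / k - 1 / (k + x)"
      using k assms by (simp add: divide_simps)
    finally show ?thesis
      by (simp add: k_def inverse_eq_divide algebra_simps)
  qed
  from sums_le[OF this 1 2] show ?thesis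
    by simp
qed

lemma trigamma_double_diff_le:
  fixes x :: real
  assumes "x > 0"
  shows "2 * (2 * Polygamma 1 (1 + 2 * x) - Polygamma 1 (1 + x)) \<le>
    2 * Polygamma 1 (1 + x) + x * Polygamma 2 (1 + x)"
proof -
  have 1: "(\<lambda>n. 2 * (2 * (1 / (1 + 2 * x + of_nat n)^2) - 1 / (1 + x + of_nat n)^2)) sums
      (2 * (2 * Polygamma 1 (1 + 2 * x) - Polygamma 1 (1 + x)))"
    using assms by (intro sums_mult sums_diff trigamma_sums) auto
  have 2: "(\<lambda>n. 2 * (1 / (1 + x + of_nat n)^2) + x * (- 2 / (1 + x + of_nat n)^3)) sums
      (2 * Polygamma 1 (1 + x) + x * Polygamma 2 (1 + x))"
    using assms by (intro sums_mult sums_add trigamma_sums tetragamma_sums) auto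
  have "2 * (2 * (1 / (1 + 2 * x + of_nat n)^2) - 1 / (1 + x + of_nat n)^2) \<le>
      2 * (1 / (1 + x + of_nat n)^2) + x * (- 2 / (1 + x + of_nat n)^3)" for n
  proof -
    \<comment> \<open>In terms of \<open>a\<close> the difference of the two summands is a single
      fraction, nonnegative because \<open>a > x > 0\<close>.\<close>
    define a where "a = 1 + x + real n"
    have a: "a > x"
      by (simp add: a_def)
    have "2 * (1 / a^2) + x * (- 2 / a^3) - 2 * (2 * (1 / (a + x)^2) - 1 / a^2) =
        2 * x * (3 * a^2 - x^2) / (a^3 * (a + x)^2)"
      using a assms by (simp add: divide_simps) algebra
    also have "\<dots> \<ge> 0"
    proof -
      have "x^2 \<le> a^2"
        using a assms by (intro power_mono) auto
      then have "x^2 \<le> 3 * a^2"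
        using zero_le_power2[of a] by linarith
      then show ?thesis
        using a assms by (intro divide_nonneg_nonneg mult_nonneg_nonneg) auto
    qed
    finally show ?thesis
      by (simp add: a_def algebra_simps)
  qed
  from sums_le[OF this 1 2] show ?thesis .
qed

section \<open>The quotient freed of its singularity, and its derivatives\<close>

definition psi_shift :: "real \<Rightarrow> real" where
  "psi_shift x = Digamma (1 + x) + euler_mascheroni"

definition central_binom :: "real \<Rightarrow> real" where
  "central_binom x = Gamma (1 + 2 * x) / Gamma (1 + x)^2"

definition psi_gap :: "real \<Rightarrow> real" where
  "psi_gap x = Digamma (1 + 2 * x) - Digamma (1 + x)"

definition quot :: "real \<Rightarrow> real" where
  "quot x = (1 - x * psi_shift x) * central_binom x"

definition quot_deriv_factor :: "real \<Rightarrow> real" where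
  "quot_deriv_factor x = 2 * (1 - x * psi_shift x) * psi_gap x
     - (psi_shift x + x * Polygamma 1 (1 + x))"

definition quot_deriv :: "real \<Rightarrow> real" where
  "quot_deriv x = quot_deriv_factor x * central_binom x"

definition quot_deriv2 :: "real \<Rightarrow> real" where
  "quot_deriv2 x =
     (2 * (1 - x * psi_shift x) * (2 * Polygamma 1 (1 + 2 * x) - Polygamma 1 (1 + x))
      - 2 * (psi_shift x + x * Polygamma 1 (1 + x)) * psi_gap x
      - (2 * Polygamma 1 (1 + x) + x * Polygamma 2 (1 + x))
      + 2 * psi_gap x * quot_deriv_factor x) * central_binom x"

text \<open>The recurrences for \<psi> and \<Gamma> produce the same factor \<open>2 / x\<close> in
  \<open>calR x\<close> and in \<open>central_binom x\<close>, so it can move from one to the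
  other.\<close>

lemma calR_div_calB:
  assumes "x > 0"
  shows "calR x / calB x = quot x"
proof -
  have nonpos: "x \<notin> \<int>\<^sub>\<le>\<^sub>0" "2 * x \<notin> \<int>\<^sub>\<le>\<^sub>0"
    using assms nonpos_Ints_nonpos by force+
  have "calR x = 2 / x * (1 - x * psi_shift x)"
    using Digamma_plus1[of x] assms
    by (simp add: calR_def psi_shift_def add.commute field_simps)
  moreover have "central_binom x = 2 / x * (Gamma (2 * x) / Gamma x ^ 2)"
    using Gamma_plus1[OF nonpos(1)] Gamma_plus1[OF nonpos(2)] assms
    by (simp add: central_binom_def add.commute power2_eq_square)
  ultimately show ?thesis
    by (simp add: quot_def calB_def)
qed

text \<open>The range \<open>x > -1/2\<close> keeps \<open>1 + x\<close> and
  \<open>1 + 2 * x\<close> positive and has 0 in its interior, which gives two-sided derivatives at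
  0.\<close>

lemma central_binom_pos: "x > -1/2 \<Longrightarrow> central_binom x > 0"
  unfolding central_binom_def by (intro divide_pos_pos zero_less_power Gamma_real_pos) auto

lemma has_real_derivative_Polygamma_shift:
  fixes x :: real
  assumes "1 + c * x > 0"
  shows "((\<lambda>x. Polygamma n (1 + c * x)) has_real_derivative c * Polygamma (Suc n) (1 + c * x)) (at x)"
proof -
  have "1 + c * x \<notin> \<int>\<^sub>\<le>\<^sub>0"
    using assms nonpos_Ints_nonpos by force
  moreover have "((\<lambda>x. 1 + c * x) has_real_derivative c) (at x)"
    by (auto intro!: derivative_eq_intros)
  ultimately show ?thesis
    by (intro DERIV_cong[OF DERIV_chain2[OF has_field_derivative_Polygamma]]) auto
qed

lemmas has_real_derivative_Polygamma_1_plus =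
  has_real_derivative_Polygamma_shift[of 1, simplified]

lemma has_real_derivative_psi_shift:
  assumes "x > -1/2"
  shows "(psi_shift has_real_derivative Polygamma 1 (1 + x)) (at x)"
  unfolding psi_shift_def[abs_def] using assms
  by (auto intro!: derivative_eq_intros has_real_derivative_Polygamma_1_plus)

lemma has_real_derivative_psi_gap:
  assumes "x > -1/2"
  shows "(psi_gap has_real_derivative 2 * Polygamma 1 (1 + 2 * x) - Polygamma 1 (1 + x)) (at x)"
  unfolding psi_gap_def[abs_def] using assms
  by (auto intro!: derivative_eq_intros has_real_derivative_Polygamma_1_plus
      has_real_derivative_Polygamma_shift)

lemma has_real_derivative_central_binom:
  assumes "x > -1/2"
  shows "(central_binom has_real_derivative 2 * psi_gap x * central_binom x) (at x)"
proof -
  have *: "((\<lambda>x. Gamma (1 + c * x)) has_real_derivative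
      c * (Gamma (1 + c * x) * Digamma (1 + c * x))) (at x)" if "1 + c * x > 0" for c
  proof -
    have "1 + c * x \<notin> \<int>\<^sub>\<le>\<^sub>0"
      using that nonpos_Ints_nonpos by force
    moreover have "((\<lambda>x. 1 + c * x) has_real_derivative c) (at x)"
      by (auto intro!: derivative_eq_intros)
    ultimately show ?thesis
      by (intro DERIV_cong[OF DERIV_chain2[OF has_field_derivative_Gamma]]) auto
  qed
  have "Gamma (1 + x) \<noteq> 0"
    using assms by (intro less_imp_neq[THEN not_sym] Gamma_real_pos) auto
  then show ?thesis
    unfolding central_binom_def[abs_def] using assms
    by (auto intro!: derivative_eq_intros *[of 2, simplified] *[of 1, simplified]
        simp: psi_gap_def field_simps power2_eq_square)
qed

lemma has_real_derivative_quot: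
  assumes "x > -1/2"
  shows "(quot has_real_derivative quot_deriv x) (at x)"
  unfolding quot_def[abs_def]
  by (rule derivative_eq_intros refl has_real_derivative_psi_shift
      has_real_derivative_central_binom assms)+
    (simp add: quot_deriv_def quot_deriv_factor_def algebra_simps)

lemma has_real_derivative_quot_deriv:
  assumes "x > -1/2"
  shows "(quot_deriv has_real_derivative quot_deriv2 x) (at x)"
  unfolding quot_deriv_def[abs_def] quot_deriv_factor_def[abs_def]
proof -
  have "1 + x \<notin> \<int>\<^sub>\<le>\<^sub>0"
    using assms nonpos_Ints_nonpos by force
  then show "((\<lambda>x. (2 * (1 - x * psi_shift x) * psi_gap x
       - (psi_shift x + x * Polygamma 1 (1 + x))) * central_binom x)
      has_real_derivative quot_deriv2 x) (at x)"
    using has_real_derivative_psi_shift[OF assms] has_real_derivative_psi_gap[OF assms]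
      has_real_derivative_central_binom[OF assms]
    \<comment> \<open>\<open>numeral_2_eq_2\<close> brings \<open>Polygamma 2\<close> to the
      successor form that differentiating \<open>Polygamma 1\<close> yields.\<close>
    by (auto intro!: derivative_eq_intros
        simp: quot_deriv2_def quot_deriv_factor_def algebra_simps numeral_2_eq_2)
qed

section \<open>Signs of the derivatives, special values and limits\<close>

lemma quot_deriv2_neg:
  assumes "x > 0"
  shows "quot_deriv2 x < 0"
proof -
  let ?S = "psi_shift x" and ?g = "psi_gap x"
  let ?g' = "2 * Polygamma 1 (1 + 2 * x) - Polygamma 1 (1 + x)"
  let ?a' = "?S + x * Polygamma 1 (1 + x)"
  let ?a'' = "2 * Polygamma 1 (1 + x) + x * Polygamma 2 (1 + x)"
  have S: "?S > 0"
    using Digamma_real_strict_mono[of 1 "1 + x"] assms by (simp add: psi_shift_def)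
  have g: "?g > 0"
    using Digamma_real_strict_mono[of "1 + x" "1 + 2 * x"] assms by (simp add: psi_gap_def)
  have "0 \<le> x * ?S * ?g'"
    using S assms trigamma_le_twice_trigamma_double[OF assms] by simp
  moreover have "0 \<le> x * ?S * ?g^2"
    using S assms by simp
  \<comment> \<open>Taken four times, this bounds the term with \<open>?a' * ?g\<close> by
    \<open>- 8 * ?g^2\<close>, so \<open>- 4 * ?g^2\<close> remains after adding
    \<open>4 * ?g^2\<close>; this makes the final inequality strict.\<close>
  moreover have "2 * ?g * ?g \<le> ?a' * ?g"
    using g Digamma_double_diff_le[OF assms]
    by (intro mult_right_mono) (auto simp: psi_gap_def psi_shift_def)
  moreover have "?g^2 > 0"
    using g by simp
  moreover have "2 * ?g' \<le> ?a''"
    by (rule trigamma_double_diff_le[OF assms])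
  ultimately have
    "- (?a'' - 2 * ?g') - 2 * (x * ?S * ?g') - 4 * (?a' * ?g) + 4 * ?g^2 - 4 * (x * ?S * ?g^2) < 0"
    unfolding power2_eq_square by linarith
  also have "- (?a'' - 2 * ?g') - 2 * (x * ?S * ?g') - 4 * (?a' * ?g) + 4 * ?g^2
        - 4 * (x * ?S * ?g^2) =
      2 * (1 - x * ?S) * ?g' - 2 * ?a' * ?g - ?a'' + 2 * ?g * quot_deriv_factor x"
    unfolding quot_deriv_factor_def by algebra
  finally show ?thesis
    using central_binom_pos[of x] assms unfolding quot_deriv2_def by (intro mult_neg_pos) auto
qed

lemma quot_0: "quot 0 = 1"
  by (simp add: quot_def central_binom_def)

text \<open>Since \<psi>(2) = 1 - \<gamma>, the factor \<open>1 - x * psi_shift x\<close> vanishes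
  at 1.\<close>

lemma quot_1: "quot 1 = 0"
  using Digamma_plus1[of "1::real"] by (simp add: quot_def psi_shift_def)

lemma quot_deriv_0: "quot_deriv 0 = 0"
  by (simp add: quot_deriv_def quot_deriv_factor_def psi_shift_def psi_gap_def)

lemma quot_deriv_strict_antimono:
  assumes "0 \<le> x" "x < y"
  shows "quot_deriv y < quot_deriv x"
\<comment> \<open>Only interior points need a negative derivative, so \<open>x = 0\<close> is
  allowed although \<open>quot_deriv2_neg\<close> does not cover it.\<close>
proof (rule DERIV_neg_imp_decreasing_open[OF assms(2)])
  show "\<exists>d. (quot_deriv has_real_derivative d) (at t) \<and> d < 0" if "x < t" "t < y" for t
    using that assms quot_deriv2_neg[of t]
    by (intro exI[of _ "quot_deriv2 t"] conjI has_real_derivative_quot_deriv) auto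
  show "continuous_on {x..y} quot_deriv"
    using assms
    by (auto intro!: DERIV_continuous_on[where D = quot_deriv2]
        has_field_derivative_at_within[OF has_real_derivative_quot_deriv])
qed

lemma quot_deriv_neg: "x > 0 \<Longrightarrow> quot_deriv x < 0"
  using quot_deriv_strict_antimono[of 0 x] quot_deriv_0 by simp

lemma continuous_on_quot: "continuous_on {0..} quot"
  by (auto intro!: DERIV_continuous_on[where D = quot_deriv]
      has_field_derivative_at_within[OF has_real_derivative_quot])

lemma quot_strict_antimono:
  assumes "0 \<le> x" "x < y"
  shows "quot y < quot x"
proof (rule DERIV_neg_imp_decreasing_open[OF assms(2)])
  show "\<exists>d. (quot has_real_derivative d) (at t) \<and> d < 0" if "x < t" "t < y" for t
    using that assms quot_deriv_neg[of t]
    by (intro exI[of _ "quot_deriv t"] conjI has_real_derivative_quot) auto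
  show "continuous_on {x..y} quot"
    using assms by (intro continuous_on_subset[OF continuous_on_quot]) auto
qed

lemma concave_on_quot: "concave_on {0<..} quot"
  by (rule f''_le0_imp_concave[where f' = quot_deriv and f'' = quot_deriv2])
    (auto intro: has_real_derivative_quot has_real_derivative_quot_deriv less_imp_le quot_deriv2_neg)

text \<open>The graph lies below its tangent at the zero 1; the negative slope there forces
  divergence to minus infinity.\<close>

lemma quot_le_tangent_1:
  assumes "x > 1"
  shows "quot x \<le> quot_deriv 1 * (x - 1)"
proof -
  obtain t where "1 < t" "quot x - quot 1 = (x - 1) * quot_deriv t"
    using MVT2[of 1 x quot quot_deriv] assms has_real_derivative_quot by force
  then show ?thesis
    using quot_deriv_strict_antimono[of 1 t] assms
    by (simp add: quot_1 mult.commute mult_left_mono)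
qed

lemma quot_at_bot: "filterlim quot at_bot at_top"
proof (rule filterlim_at_bot_mono)
  have "filterlim (\<lambda>x. x - 1) at_top (at_top :: real filter)"
    using filterlim_tendsto_add_at_top[OF tendsto_const[of "-1 :: real"] filterlim_ident] by simp
  then show "filterlim (\<lambda>x. quot_deriv 1 * (x - 1)) at_bot at_top"
    using quot_deriv_neg[of 1] by (intro filterlim_tendsto_neg_mult_at_bot[OF tendsto_const]) auto
  show "eventually (\<lambda>x. quot x \<le> quot_deriv 1 * (x - 1)) at_top"
    using eventually_gt_at_top[of 1] by eventually_elim (rule quot_le_tangent_1)
qed

text \<open>Strict decrease from 1 at 0 to 0 at 1 gives one inclusion, the intermediate value
  theorem the other.\<close>

lemma quot_image: "quot ` {0<..<1} = {0<..<1}"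
proof (intro subset_antisym subsetI)
  fix y assume "y \<in> quot ` {0<..<1}"
  then obtain x where "0 < x" "x < 1" "y = quot x"
    by auto
  then show "y \<in> {0<..<1}"
    using quot_strict_antimono[of 0 x] quot_strict_antimono[of x 1] by (simp add: quot_0 quot_1)
next
  fix y :: real assume y: "y \<in> {0<..<1}"
  obtain x where x: "0 \<le> x" "x \<le> 1" "quot x = y"
    using IVT2'[of quot 1 y 0] y continuous_on_subset[OF continuous_on_quot, of "{0..1}"]
    by (auto simp: quot_0 quot_1)
  with y have "x \<noteq> 0" "x \<noteq> 1"
    by (auto simp: quot_0 quot_1)
  with x show "y \<in> quot ` {0<..<1}"
    by force
qed

theorem theorem5:
  shows "strict_antimono_on {0<..} (\<lambda>x. calR x / calB x) \<and>
         concave_on {0<..} (\<lambda>x. calR x / calB x) \<and>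
         ((\<lambda>x. calR x / calB x) \<longlongrightarrow> 1) (at_right 0) \<and>
         filterlim (\<lambda>x. calR x / calB x) at_bot at_top \<and>
         strict_antimono_on {0<..<1} (\<lambda>x. calR x / calB x) \<and>
         concave_on {0<..<1} (\<lambda>x. calR x / calB x) \<and>
         (\<lambda>x. calR x / calB x) ` {0<..<1} = {0<..<1}"
proof (intro conjI)
  let ?F = "\<lambda>x. calR x / calB x"
  show "strict_antimono_on {0<..} ?F" "strict_antimono_on {0<..<1} ?F"
    by (auto simp: monotone_on_def calR_div_calB intro: quot_strict_antimono)
  show concave: "concave_on {0<..} ?F"
    \<comment> \<open>The identity with \<open>quot\<close> is known for positive arguments only, so
      the convex combination must first be shown positive.\<close>
    unfolding concave_on_iff
  proof (intro conjI ballI allI impI)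
    fix x y u v :: real
    assume *: "x \<in> {0<..}" "y \<in> {0<..}" "0 \<le> u" "0 \<le> v" "u + v = 1"
    then have "u * x + v * y \<in> {0<..}"
      using convexD[OF convex_real_interval(3)[of 0], of x y u v] by simp
    with * show "u * ?F x + v * ?F y \<le> ?F (u *\<^sub>R x + v *\<^sub>R y)"
      using concave_on_quot by (simp add: concave_on_iff calR_div_calB)
  qed simp
  show "concave_on {0<..<1} ?F"
    using concave unfolding concave_on_def by (rule convex_on_subset) auto
  \<comment> \<open>The singularity is removed in \<open>quot\<close>, so the limit is its value at
    0.\<close>
  have "(quot \<longlongrightarrow> 1) (at 0)"
    using DERIV_isCont[OF has_real_derivative_quot[of 0]] by (simp add: isCont_def quot_0)
  then have "(quot \<longlongrightarrow> 1) (at_right 0)"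
    by (rule filterlim_mono) (auto simp: at_le)
  then show "(?F \<longlongrightarrow> 1) (at_right 0)"
    by (rule Lim_transform_eventually)
      (auto simp: eventually_at_right_less calR_div_calB intro: eventually_at_rightI[of 0 1])
  show "filterlim ?F at_bot at_top"
  proof (rule filterlim_cong[THEN iffD1, OF refl refl _ quot_at_bot])
    show "eventually (\<lambda>x. quot x = ?F x) at_top"
      using eventually_gt_at_top[of "0::real"] by eventually_elim (simp add: calR_div_calB)
  qed
  have "?F ` {0<..<1} = quot ` {0<..<1}"
    by (intro image_cong) (auto simp: calR_div_calB)
  then show "?F ` {0<..<1} = {0<..<1}"
    by (simp add: quot_image)
qed

end
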